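(* Let $\alpha,\beta\in\mathbb{C}$ be algebraic integers such that the number fields $\mathbb{Q}(\alpha)$ and $\mathbb{Q}(\beta)$ are linearly disjoint. Let $p$ be a prime number, let $(r,p)$ be a first-degree prime ideal of $\mathbb{Z}[\alpha]$ and let $(s,p)$ be a first-degree prime ideal of $\mathbb{Z}[\beta]$. Then $(r+s,p)$ is a first-degree prime ideal of $\mathbb{Z}[\alpha+\beta]$.
   Context: Two number fields $L_1,L_2\subset\mathbb{C}$ are linearly disjoint if the natural $\mathbb{Q}$-algebra homomorphism $L_1\otimes_{\mathbb{Q}}L_2\to L_1L_2$, $a\otimes b\mapsto ab$, is injective; equivalently $[L_1L_2:\mathbb{Q}]=[L_1:\mathbb{Q}][L_2:\mathbb{Q}]$. For an algebraic integer $\theta$, a first-degree prime ideal of $\mathbb{Z}[\theta]$ is a non-zero prime ideal $\mathfrak{p}$ of $\mathbb{Z}[\theta]$ whose norm $[\mathbb{Z}[\theta]:\mathfrak{p}]$ is a prime number. If $h\in\mathbb{Z}[x]$ is the (monic) minimal polynomial of $\theta$ over $\mathbb{Q}$, the first-degree prime ideals of $\mathbb{Z}[\theta]$ of norm $p$ are in bijection with the pairs $(t,p)$ with $t\in\mathbb{F}_p$ and $h(t)=0$ in $\mathbb{F}_p$; the pair $(t,p)$ denotes the ideal which is the kernel of the ring homomorphism $\mathbb{Z}[\theta]\to\mathbb{F}_p$, $\theta\mapsto t$. Thus "$(t,p)$ is a first-degree prime ideal of $\mathbb{Z}[\theta]$" means that $p$ is a prime and $t\in\mathbb{F}_p$ is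 a root of $h \bmod p$. *)

theory Defs
  imports
    "HOL-Algebra.Generated_Fields"
    "HOL-Algebra.Free_Abelian_Groups"
    "HOL-Algebra.Algebraic_Closure_Type"
    "HOL-Computational_Algebra.Computational_Algebra"
    "HOL-Number_Theory.Number_Theory"
begin

section \<open>Linear disjointness\<close>

text \<open>The smallest subfield of the complex numbers containing \<open>\<theta>\<close>; it contains the rationals,
  the characteristic being zero.\<close>

definition rat_adjoin :: "complex \<Rightarrow> complex set" where
  "rat_adjoin \<theta> = generate_field ring_of_type_algebra {\<theta>}"

text \<open>The tensor product over the rationals is the free abelian group on \<open>L1 \<times> L2\<close> modulo the
  subgroup generated by biadditivity and by \<open>qa \<otimes> b = a \<otimes> qb\<close> for rational \<open>q\<close>.\<close>

definition tensor_relations :: "complex set \<Rightarrow> complex set \<Rightarrow> (complex \<times> complex \<Rightarrow>\<^sub>0 int) set" where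
  "tensor_relations L1 L2 =
     {frag_of (a + a', b) - frag_of (a, b) - frag_of (a', b) | a a' b.
        a \<in> L1 \<and> a' \<in> L1 \<and> b \<in> L2}
   \<union> {frag_of (a, b + b') - frag_of (a, b) - frag_of (a, b') | a b b'.
        a \<in> L1 \<and> b \<in> L2 \<and> b' \<in> L2}
   \<union> {frag_of (of_rat q * a, b) - frag_of (a, of_rat q * b) | q a b.
        a \<in> L1 \<and> b \<in> L2}"

definition tensor_subgroup :: "complex set \<Rightarrow> complex set \<Rightarrow> (complex \<times> complex \<Rightarrow>\<^sub>0 int) set" where
  "tensor_subgroup L1 L2 = generate (free_Abelian_group (L1 \<times> L2)) (tensor_relations L1 L2)"

definition rat_tensor ::
  "complex set \<Rightarrow> complex set \<Rightarrow> (complex \<times> complex \<Rightarrow>\<^sub>0 int) set monoid" where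
  "rat_tensor L1 L2 = free_Abelian_group (L1 \<times> L2) Mod tensor_subgroup L1 L2"

definition pure_tensor :: "complex set \<Rightarrow> complex set \<Rightarrow> complex \<Rightarrow> complex
    \<Rightarrow> (complex \<times> complex \<Rightarrow>\<^sub>0 int) set" where
  "pure_tensor L1 L2 a b = tensor_subgroup L1 L2 #>\<^bsub>free_Abelian_group (L1 \<times> L2)\<^esub> frag_of (a, b)"

definition formal_mult :: "(complex \<times> complex \<Rightarrow>\<^sub>0 int) \<Rightarrow> complex" where
  "formal_mult c = (\<Sum>x\<in>Poly_Mapping.keys c. of_int (Poly_Mapping.lookup c x) * (fst x * snd x))"

text \<open>\<open>formal_mult\<close> is constant on cosets of \<open>tensor_subgroup\<close> (lemma \<open>tensor_mult_coset\<close>), so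
  \<open>the_elem\<close> picks its unique value.\<close>

definition tensor_mult :: "(complex \<times> complex \<Rightarrow>\<^sub>0 int) set \<Rightarrow> complex" where
  "tensor_mult C = the_elem (formal_mult ` C)"

definition linearly_disjoint :: "complex set \<Rightarrow> complex set \<Rightarrow> bool" where
  "linearly_disjoint L1 L2 \<longleftrightarrow> inj_on tensor_mult (carrier (rat_tensor L1 L2))"

lemma formal_mult_supset:
  assumes "finite A" "Poly_Mapping.keys c \<subseteq> A"
  shows "formal_mult c = (\<Sum>x\<in>A. of_int (Poly_Mapping.lookup c x) * (fst x * snd x))"
  unfolding formal_mult_def
  by (rule sum.mono_neutral_left) (use assms in \<open>auto simp: in_keys_iff\<close>)

lemma formal_mult_0 [simp]: "formal_mult 0 = 0"
  by (simp add: formal_mult_def)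

lemma formal_mult_add: "formal_mult (c + d) = formal_mult c + formal_mult d"
proof -
  let ?A = "Poly_Mapping.keys c \<union> Poly_Mapping.keys d"
  have "Poly_Mapping.keys (c + d) \<subseteq> ?A"
    by (rule keys_add)
  then show ?thesis
    by (simp add: formal_mult_supset[of ?A] lookup_add algebra_simps sum.distrib)
qed

lemma formal_mult_uminus: "formal_mult (- c) = - formal_mult c"
  using formal_mult_add[of c "- c"] by (simp add: eq_neg_iff_add_eq_0 add.commute)

lemma formal_mult_diff: "formal_mult (c - d) = formal_mult c - formal_mult d"
  using formal_mult_add[of c "- d"] by (simp add: formal_mult_uminus)

lemma formal_mult_frag_of [simp]: "formal_mult (frag_of (a, b)) = a * b"
  by (simp add: formal_mult_def)

lemma subfield_of_rat_mult:
  assumes "subfield L (ring_of_type_algebra :: complex ring)" and "a \<in> L"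
  shows "of_rat q * a \<in> L"
proof -
  let ?R = "ring_of_type_algebra :: complex ring"
  interpret field ?R by (rule field_from_type_algebra)
  note L = assms(1)
  have simps: "\<one>\<^bsub>?R\<^esub> = 1" "\<zero>\<^bsub>?R\<^esub> = 0" "x \<oplus>\<^bsub>?R\<^esub> y = x + y" "x \<otimes>\<^bsub>?R\<^esub> y = x * y" for x y
    by (simp_all add: ring_of_type_algebra_def)
  have neg: "\<ominus>\<^bsub>?R\<^esub> x = - x" for x
    by (rule minus_equality) (auto simp: ring_of_type_algebra_def)
  have one: "1 \<in> L"
    using subringE(3)[OF subfieldE(1)[OF L]] by (simp add: simps)
  have zero: "0 \<in> L"
    using subringE(2)[OF subfieldE(1)[OF L]] by (simp add: simps)
  have add: "x + y \<in> L" if "x \<in> L" "y \<in> L" for x y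
    using subringE(7)[OF subfieldE(1)[OF L] that] by (simp add: simps)
  have mult: "x * y \<in> L" if "x \<in> L" "y \<in> L" for x y
    using subringE(6)[OF subfieldE(1)[OF L] that] by (simp add: simps)
  have uminus: "- x \<in> L" if "x \<in> L" for x
    using subringE(5)[OF subfieldE(1)[OF L] that] by (simp add: neg)
  have inv: "inverse x \<in> L" if "x \<in> L" for x
  proof (cases "x = 0")
    case False
    have "inv\<^bsub>?R\<^esub> x \<in> L"
      using subfield_m_inv(1)[OF L, of x] that False by (simp add: simps)
    moreover have "x * inv\<^bsub>?R\<^esub> x = 1"
      using subfield_m_inv(2)[OF L, of x] that False by (simp add: simps)
    ultimately show ?thesis
      by (simp add: inverse_unique)
  qed (use zero in simp)
  have nat: "of_nat n \<in> L" for n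
    by (induction n) (use zero one add in auto)
  have int: "of_int k \<in> L" for k
  proof (cases k)
    case (nonneg n)
    then show ?thesis using nat[of n] by simp
  next
    case (neg n)
    then show ?thesis using uminus[OF nat[of "Suc n"]] by simp
  qed
  have "of_rat q \<in> L"
    by (cases q) (use mult[OF int inv[OF int]] in \<open>simp add: of_rat_rat divide_inverse\<close>)
  then show ?thesis
    using mult assms(2) by blast
qed

lemma subfield_add:
  assumes "subfield L (ring_of_type_algebra :: complex ring)" and "a \<in> L" "b \<in> L"
  shows "a + b \<in> L"
proof -
  interpret field "ring_of_type_algebra :: complex ring" by (rule field_from_type_algebra)
  show ?thesis
    using subringE(7)[OF subfieldE(1)[OF assms(1)] assms(2,3)]
    by (simp add: ring_of_type_algebra_def)
qed

lemma subfield_rat_adjoin: "subfield (rat_adjoin \<theta>) ring_of_type_algebra"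
proof -
  interpret field "ring_of_type_algebra :: complex ring" by (rule field_from_type_algebra)
  show ?thesis
    unfolding rat_adjoin_def
    by (rule generate_field_is_subfield) (simp add: ring_of_type_algebra_def)
qed

lemma keys_relation_subset:
  assumes "x \<in> S" "y \<in> S" "z \<in> S"
  shows "Poly_Mapping.keys (frag_of x - frag_of y - frag_of z) \<subseteq> S"
    and "Poly_Mapping.keys (frag_of x - frag_of y) \<subseteq> S"
  using assms keys_diff[of "frag_of x - frag_of y" "frag_of z"]
    keys_diff[of "frag_of x" "frag_of y"] by auto

lemma tensor_relations_carrier:
  assumes "subfield L1 (ring_of_type_algebra :: complex ring)"
    and "subfield L2 (ring_of_type_algebra :: complex ring)"
  shows "tensor_relations L1 L2 \<subseteq> carrier (free_Abelian_group (L1 \<times> L2))"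
proof
  fix c assume "c \<in> tensor_relations L1 L2"
  moreover have "Poly_Mapping.keys (frag_of (a + a', b) - frag_of (a, b) - frag_of (a', b)) \<subseteq> L1 \<times> L2"
    if "a \<in> L1" "a' \<in> L1" "b \<in> L2" for a a' b
    by (rule keys_relation_subset) (use that subfield_add[OF assms(1)] in auto)
  moreover have "Poly_Mapping.keys (frag_of (a, b + b') - frag_of (a, b) - frag_of (a, b')) \<subseteq> L1 \<times> L2"
    if "a \<in> L1" "b \<in> L2" "b' \<in> L2" for a b b'
    by (rule keys_relation_subset) (use that subfield_add[OF assms(2)] in auto)
  moreover have "Poly_Mapping.keys (frag_of (of_rat q * a, b) - frag_of (a, of_rat q * b)) \<subseteq> L1 \<times> L2"
    if "a \<in> L1" "b \<in> L2" for q a b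
    by (rule keys_relation_subset(2)[where z = "(a, b)"])
      (use that subfield_of_rat_mult[OF assms(1)] subfield_of_rat_mult[OF assms(2)] in auto)
  ultimately show "c \<in> carrier (free_Abelian_group (L1 \<times> L2))"
    unfolding carrier_free_Abelian_group_iff tensor_relations_def by blast
qed

lemma formal_mult_tensor_subgroup:
  assumes "tensor_relations L1 L2 \<subseteq> carrier (free_Abelian_group (L1 \<times> L2))"
    and "c \<in> tensor_subgroup L1 L2"
  shows "formal_mult c = 0"
  using assms(2) unfolding tensor_subgroup_def
proof (induction rule: generate.induct)
  case one
  then show ?case by simp
next
  case (incl h)
  then show ?case
    unfolding tensor_relations_def
    by (elim UnE CollectE exE conjE) (simp_all add: formal_mult_diff ring_distribs)
next
  case (inv h)
  have "inv\<^bsub>free_Abelian_group (L1 \<times> L2)\<^esub> h = - h"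
    using subsetD[OF assms(1) inv] inv_free_Abelian_group
    unfolding carrier_free_Abelian_group_iff by blast
  moreover have "formal_mult h = 0"
    using inv unfolding tensor_relations_def
    by (elim UnE CollectE exE conjE) (simp_all add: formal_mult_diff ring_distribs)
  ultimately show ?case
    by (simp add: formal_mult_uminus)
next
  case (eng h1 h2)
  then show ?case by (simp add: formal_mult_add)
qed

lemma tensor_mult_coset:
  assumes "tensor_relations L1 L2 \<subseteq> carrier (free_Abelian_group (L1 \<times> L2))"
  shows "tensor_mult (tensor_subgroup L1 L2 #>\<^bsub>free_Abelian_group (L1 \<times> L2)\<^esub> c) = formal_mult c"
proof -
  have "0 \<in> tensor_subgroup L1 L2"
    unfolding tensor_subgroup_def using generate.one[of "free_Abelian_group (L1 \<times> L2)"] by simp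
  then have "formal_mult ` (tensor_subgroup L1 L2 #>\<^bsub>free_Abelian_group (L1 \<times> L2)\<^esub> c)
      = {formal_mult c}"
    using formal_mult_tensor_subgroup[OF assms]
    by (fastforce simp: r_coset_def formal_mult_add)
  then show ?thesis by (simp add: tensor_mult_def)
qed

lemma tensor_mult_pure_tensor:
  assumes "tensor_relations L1 L2 \<subseteq> carrier (free_Abelian_group (L1 \<times> L2))"
  shows "tensor_mult (pure_tensor L1 L2 a b) = a * b"
  using tensor_mult_coset[OF assms] by (simp add: pure_tensor_def)


section \<open>First-degree prime ideals\<close>

definition is_rat_minpoly :: "complex \<Rightarrow> rat poly \<Rightarrow> bool" where
  "is_rat_minpoly \<theta> h \<longleftrightarrow> Polynomial.lead_coeff h = 1 \<and> poly (map_poly of_rat h) \<theta> = 0 \<and>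
     (\<forall>g. g \<noteq> 0 \<and> poly (map_poly of_rat g) \<theta> = 0 \<longrightarrow> Polynomial.degree h \<le> Polynomial.degree g)"

text \<open>For an algebraic integer the minimal polynomial over the rationals has integer
  coefficients (lemma \<open>int_minpoly\<close>).\<close>

definition int_minpoly :: "complex \<Rightarrow> int poly" where
  "int_minpoly \<theta> = (THE h. is_rat_minpoly \<theta> (map_poly of_int h))"

text \<open>The elements of the prime field are the least non-negative residues, and evaluating over the
  integers and then reducing is the same as evaluating the reduced polynomial. The pair \<open>(t, p)\<close>
  stands for the kernel of the ring homomorphism from the integers adjoined \<open>\<theta>\<close> to the prime
  field sending \<open>\<theta>\<close> to \<open>t\<close>.\<close>

definition first_degree_prime_ideal :: "complex \<Rightarrow> int \<times> nat \<Rightarrow> bool" where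
  "first_degree_prime_ideal \<theta> = (\<lambda>(t, p). Factorial_Ring.prime p \<and>
     t \<in> carrier (residue_ring (int p)) \<and> [poly (int_minpoly \<theta>) t = 0] (mod int p))"

lemma map_poly_of_rat_diff:
  "map_poly of_rat (g - h) = (map_poly of_rat g - map_poly of_rat h :: complex poly)"
  by (rule poly_eqI) (simp add: coeff_map_poly of_rat_diff)

lemma map_poly_of_rat_mult:
  "map_poly of_rat (g * h) = (map_poly of_rat g * map_poly of_rat h :: complex poly)"
  by (rule poly_eqI) (simp add: coeff_map_poly coeff_mult of_rat_sum of_rat_mult)

lemma map_poly_of_int_rat_mult:
  "map_poly of_int (g * h) = (map_poly of_int g * map_poly of_int h :: rat poly)"
  by (rule poly_eqI) (simp add: coeff_map_poly coeff_mult)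

lemma map_poly_of_int_rat_eq_iff:
  "map_poly of_int g = (map_poly of_int h :: rat poly) \<longleftrightarrow> g = h"
  by (auto simp: poly_eq_iff coeff_map_poly)

lemma is_rat_minpoly_unique:
  assumes "is_rat_minpoly \<theta> g" "is_rat_minpoly \<theta> h"
  shows "g = h"
proof (rule ccontr)
  assume neq: "g \<noteq> h"
  have g: "Polynomial.lead_coeff g = 1" "poly (map_poly of_rat g) \<theta> = 0"
    and h: "Polynomial.lead_coeff h = 1" "poly (map_poly of_rat h) \<theta> = 0"
    using assms by (auto simp: is_rat_minpoly_def)
  have "g \<noteq> 0" "h \<noteq> 0"
    using g(1) h(1) by auto
  then have deg: "Polynomial.degree g = Polynomial.degree h"
    using assms by (intro antisym) (auto simp: is_rat_minpoly_def)
  have "poly (map_poly of_rat (g - h)) \<theta> = 0"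
    using g(2) h(2) by (simp add: map_poly_of_rat_diff)
  then have "Polynomial.degree g \<le> Polynomial.degree (g - h)"
    using assms(1) neq by (auto simp: is_rat_minpoly_def)
  moreover have "Polynomial.coeff (g - h) (Polynomial.degree g) = 0"
    using g(1) h(1) deg by simp
  moreover have "Polynomial.degree (g - h) \<le> Polynomial.degree g"
    using deg by (simp add: degree_diff_le)
  ultimately show False
    using neq by (metis antisym eq_iff_diff_eq_0 leading_coeff_0_iff)
qed

lemma clear_denominators:
  fixes q :: "rat poly"
  obtains a :: int and Q :: "int poly" where "a > 0" "smult (of_int a) q = map_poly of_int Q"
proof -
  have "\<exists>a Q. a > (0::int) \<and> smult (of_int a) q = map_poly of_int Q"
  proof (induction q)
    case 0
    show ?case by (rule exI[of _ 1], rule exI[of _ 0]) simp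
  next
    case (pCons c q)
    then obtain a Q where aQ: "a > (0::int)" "smult (of_int a) q = map_poly of_int Q" by blast
    obtain m n :: int where c: "c = of_int m / of_int n" "n > 0"
      by (metis quotient_of_denom_pos' quotient_of_div prod.collapse)
    have "smult (of_int (n * a)) (pCons c q) = map_poly of_int (pCons (a * m) (smult n Q))"
    proof (rule poly_eqI)
      fix i
      have "of_int a * Polynomial.coeff q j = of_int (Polynomial.coeff Q j)" for j
        using arg_cong[OF aQ(2), of "\<lambda>p. Polynomial.coeff p j"] by (simp add: coeff_map_poly)
      then show "Polynomial.coeff (smult (of_int (n * a)) (pCons c q)) i
          = Polynomial.coeff (map_poly of_int (pCons (a * m) (smult n Q))) i"
        using c by (cases i) (auto simp: coeff_map_poly)
    qed
    moreover have "n * a > 0" using c aQ by simp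
    ultimately show ?case by blast
  qed
  then show ?thesis using that by blast
qed

lemma monic_factor_integral:
  fixes q r :: "rat poly" and P :: "int poly"
  assumes P: "Polynomial.lead_coeff P = 1" "map_poly of_int P = q * r"
    and q: "Polynomial.lead_coeff q = 1"
  obtains Q :: "int poly" where "q = map_poly of_int Q"
proof -
  have lc_of_int: "Polynomial.lead_coeff (map_poly of_int F :: rat poly)
      = of_int (Polynomial.lead_coeff F)" for F :: "int poly"
    by (simp add: coeff_map_poly degree_map_poly)
  have r: "Polynomial.lead_coeff r = 1"
    using arg_cong[OF P(2), of Polynomial.lead_coeff] P(1) q
    unfolding lc_of_int lead_coeff_mult by simp
  obtain a Q where a: "a > 0" "smult (of_int a) q = map_poly of_int Q"
    by (rule clear_denominators)
  obtain b R where b: "b > 0" "smult (of_int b) r = map_poly of_int R"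
    by (rule clear_denominators)
  have lcQ: "Polynomial.lead_coeff Q = a"
    using arg_cong[OF a(2), of Polynomial.lead_coeff] q a(1) unfolding lc_of_int by simp
  have lcR: "Polynomial.lead_coeff R = b"
    using arg_cong[OF b(2), of Polynomial.lead_coeff] r b(1) unfolding lc_of_int by simp
  have "map_poly of_int (Q * R) = (smult (of_int (a * b)) (q * r) :: rat poly)"
    unfolding map_poly_of_int_rat_mult a(2)[symmetric] b(2)[symmetric]
    by (simp add: mult.commute)
  also have "\<dots> = map_poly of_int (smult (a * b) P)"
    unfolding P(2)[symmetric] by (rule poly_eqI) (simp add: coeff_map_poly)
  finally have QR: "Q * R = smult (a * b) P"
    by (simp only: map_poly_of_int_rat_eq_iff)
  have "content P dvd 1"
    using content_dvd_coeff[of P "Polynomial.degree P"] P(1) by simp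
  then have "content P = 1" by (simp only: is_unit_content_iff)
  then have cc: "content Q * content R = a * b"
    using arg_cong[OF QR, of content] a b by (simp add: content_mult)
  have "content Q dvd a" "content R dvd b"
    using content_dvd_coeff[of Q "Polynomial.degree Q"]
      content_dvd_coeff[of R "Polynomial.degree R"] lcQ lcR by auto
  then have le: "content Q \<le> a" "content R \<le> b"
    using a b by (auto intro: zdvd_imp_le)
  have "content Q = a"
  proof (rule ccontr)
    assume "content Q \<noteq> a"
    then have "content Q < a" using le by simp
    moreover have "content R > 0"
      using cc a(1) b(1) le
      by (metis content_eq_zero_iff lcR leading_coeff_0_iff less_irrefl mult_eq_0_iff
          normalize_content abs_ge_zero normalize_int_def order_less_le)
    ultimately have "content Q * content R < a * b"
      using le a(1) by (smt (verit) mult_strict_right_mono mult_left_mono)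
    then show False using cc by simp
  qed
  then have "[:a:] dvd Q"
    using content_dvd[of Q] by simp
  then obtain K where K: "Q = smult a K"
    by (auto elim: dvdE)
  have "q = map_poly of_int K"
  proof (rule poly_eqI)
    fix i
    have "of_int a * Polynomial.coeff q i = of_int a * (of_int (Polynomial.coeff K i) :: rat)"
      using arg_cong[OF a(2), of "\<lambda>p. Polynomial.coeff p i"] by (simp add: coeff_map_poly K)
    then show "Polynomial.coeff q i = Polynomial.coeff (map_poly of_int K) i"
      using a(1) by (simp add: coeff_map_poly)
  qed
  then show ?thesis by (rule that)
qed

lemma rat_minpoly_exists:
  assumes "algebraic_int \<theta>"
  obtains h :: "int poly" where "is_rat_minpoly \<theta> (map_poly of_int h)"
proof -
  obtain P :: "int poly" where P: "poly (map_poly of_int P) \<theta> = 0" "Polynomial.lead_coeff P = 1"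
    using assms by (auto simp: algebraic_int_altdef_ipoly)
  let ?P = "map_poly of_int P :: rat poly"
  let ?ann = "\<lambda>g. g \<noteq> 0 \<and> poly (map_poly of_rat g) \<theta> = 0"
  have "map_poly of_rat ?P = (map_poly of_int P :: complex poly)"
    by (rule poly_eqI) (simp add: coeff_map_poly)
  moreover have "P \<noteq> 0"
    using P(2) by auto
  then have "?P \<noteq> 0"
    using map_poly_of_int_rat_eq_iff[of P 0] by simp
  ultimately have "?ann ?P"
    using P(1) by simp
  then obtain g where g: "?ann g" "\<And>f. ?ann f \<Longrightarrow> Polynomial.degree g \<le> Polynomial.degree f"
    using ex_has_least_nat[of ?ann ?P Polynomial.degree] by blast
  define h where "h = smult (inverse (Polynomial.lead_coeff g)) g"
  have "map_poly of_rat h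
      = (smult (of_rat (inverse (Polynomial.lead_coeff g))) (map_poly of_rat g) :: complex poly)"
    by (rule poly_eqI) (simp add: h_def coeff_map_poly of_rat_mult)
  then have h: "is_rat_minpoly \<theta> h"
    using g by (auto simp: is_rat_minpoly_def h_def)
  then have h1: "Polynomial.lead_coeff h = 1" "poly (map_poly of_rat h) \<theta> = 0"
    by (auto simp: is_rat_minpoly_def)
  have "?P mod h = 0"
  proof (rule ccontr)
    assume neq: "?P mod h \<noteq> 0"
    have "?P mod h = ?P - h * (?P div h)"
      by (simp add: minus_mult_div_eq_mod)
    then have "poly (map_poly of_rat (?P mod h)) \<theta> = 0"
      using \<open>?ann ?P\<close> h1(2) by (simp add: map_poly_of_rat_diff map_poly_of_rat_mult)
    then have "Polynomial.degree h \<le> Polynomial.degree (?P mod h)"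
      using h neq by (auto simp: is_rat_minpoly_def)
    moreover have "h \<noteq> 0" using h1(1) by auto
    ultimately show False
      using degree_mod_less[of h ?P] neq by auto
  qed
  then have "?P = h * (?P div h)"
    by (metis add.right_neutral mult_div_mod_eq)
  then obtain Q where "h = map_poly of_int Q"
    using monic_factor_integral P(2) h1(1) by metis
  then show ?thesis
    using h that by blast
qed

lemma int_minpoly:
  assumes "algebraic_int \<theta>"
  shows "is_rat_minpoly \<theta> (map_poly of_int (int_minpoly \<theta>))"
  unfolding int_minpoly_def
proof (rule theI')
  show "\<exists>!h. is_rat_minpoly \<theta> (map_poly of_int h)"
    using rat_minpoly_exists[OF assms] is_rat_minpoly_unique map_poly_of_int_rat_eq_iff by metis
qed

end

(*
  Reducing powers modulo the minimal polynomials f, g of \<alpha>, \<beta> gives integers e_ij, depending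
  only on f, g and the minimal polynomial h of \<alpha> + \<beta>, such that h(x + y) equals the sum of
  e_ij x^i y^j over i < deg f, j < deg g whenever f(x) = g(y) = 0. At (\<alpha>, \<beta>) the sum vanishes, so
  linear disjointness forces all e_ij to be 0; at (r, s) modulo p this yields h(r + s) = 0.
  Integrality of \<alpha> + \<beta> is needed for h to have integer coefficients at all: \<alpha> + \<beta> is an
  eigenvalue of the integer matrix of multiplication on the products \<alpha>^i \<beta>^j.
*)

theory Submission
  imports Defs "Jordan_Normal_Form.Char_Poly"
begin

section \<open>Reduction of powers modulo a monic polynomial\<close>

text \<open>Pseudo-division is available over the integers; for monic \<open>f\<close> its scaling
  factor is 1, so this is ordinary division with remainder.\<close>

definition power_coeff :: "int poly \<Rightarrow> nat \<Rightarrow> nat \<Rightarrow> int" where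
  "power_coeff f k i = Polynomial.coeff (pseudo_mod (Polynomial.monom 1 k) f) i"

text \<open>An identity in Z[x], so it can be evaluated at a complex root of \<open>f\<close> as
  well as at a root modulo p.\<close>

lemma power_coeff_poly:
  fixes f :: "int poly"
  assumes "Polynomial.lead_coeff f = 1"
  obtains q where "Polynomial.monom 1 k =
    f * q + (\<Sum>i<Polynomial.degree f. Polynomial.monom (power_coeff f k i) i)"
proof -
  obtain q u where qu: "pseudo_divmod (Polynomial.monom 1 k) f = (q, u)"
    by fastforce
  have f: "f \<noteq> 0"
    using assms by auto
  have eq: "Polynomial.monom 1 k = f * q + u"
    using pseudo_divmod(1)[OF f qu] assms by simp
  \<comment> \<open>The case \<open>u = 0\<close> also covers constant \<open>f\<close>, where the
    sum below is empty.\<close>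
  have u: "u = 0 \<or> Polynomial.degree u < Polynomial.degree f"
    using pseudo_divmod(2)[OF f qu] .
  have "u = (\<Sum>i<Polynomial.degree f. Polynomial.monom (power_coeff f k i) i)"
  proof (rule poly_eqI)
    fix n
    have "Polynomial.coeff u n = 0" if "n \<ge> Polynomial.degree f"
      using u that by (auto intro: coeff_eq_0)
    then show "Polynomial.coeff u n = Polynomial.coeff
        (\<Sum>i<Polynomial.degree f. Polynomial.monom (power_coeff f k i) i) n"
      using qu by (auto simp: coeff_sum power_coeff_def pseudo_mod_def if_distrib cong: if_cong)
  qed
  then show ?thesis
    using eq by (intro that[of q]) simp
qed

lemma power_eq_power_coeff:
  fixes x :: complex
  assumes "Polynomial.lead_coeff f = 1" and "poly (map_poly of_int f) x = 0"
  shows "x ^ k = (\<Sum>i<Polynomial.degree f. of_int (power_coeff f k i) * x ^ i)"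
proof -
  obtain q where q: "Polynomial.monom 1 k =
      f * q + (\<Sum>i<Polynomial.degree f. Polynomial.monom (power_coeff f k i) i)"
    using power_coeff_poly[OF assms(1)] .
  have "map_poly of_int (Polynomial.monom 1 k) = (map_poly of_int f * map_poly of_int q
      + (\<Sum>i<Polynomial.degree f. Polynomial.monom (of_int (power_coeff f k i)) i) :: complex poly)"
    unfolding q by (rule poly_eqI) (simp add: coeff_map_poly coeff_mult coeff_sum if_distrib cong: if_cong)
  from arg_cong[OF this, of "\<lambda>P. poly P x"] show ?thesis
    using assms(2) by (simp add: poly_sum poly_monom map_poly_monom)
qed

lemma power_cong_power_coeff:
  fixes r p :: int
  assumes "Polynomial.lead_coeff f = 1" and "[poly f r = 0] (mod p)"
  shows "[r ^ k = (\<Sum>i<Polynomial.degree f. power_coeff f k i * r ^ i)] (mod p)"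
proof -
  obtain q where q: "Polynomial.monom 1 k =
      f * q + (\<Sum>i<Polynomial.degree f. Polynomial.monom (power_coeff f k i) i)"
    using power_coeff_poly[OF assms(1)] .
  have "r ^ k = poly f r * poly q r + (\<Sum>i<Polynomial.degree f. power_coeff f k i * r ^ i)"
    using arg_cong[OF q, of "\<lambda>P. poly P r"] by (simp add: poly_sum poly_monom)
  moreover have "[poly f r * poly q r + t = 0 * poly q r + t] (mod p)" for t
    using assms(2) by (intro cong_add cong_mult cong_refl)
  ultimately show ?thesis
    by simp
qed

text \<open>The integers e_ij: h(x + y) is expanded by the binomial theorem, then x^l and y^(k-l)
  are replaced by their remainders modulo f and g.\<close>

definition sum_coeff :: "int poly \<Rightarrow> int poly \<Rightarrow> int poly \<Rightarrow> nat \<Rightarrow> nat \<Rightarrow> int" where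
  "sum_coeff f g h i j = (\<Sum>k\<le>Polynomial.degree h. \<Sum>l\<le>k.
     Polynomial.coeff h k * of_nat (k choose l) * power_coeff f l i * power_coeff g (k - l) j)"

text \<open>Only finite sums are interchanged, so any commutative ring works; the instances used are
  the complex numbers and the integers.\<close>

lemma sum_coeff_expand:
  fixes x y :: "'a::comm_ring_1"
  shows "(\<Sum>i<m. \<Sum>j<n. of_int (sum_coeff f g h i j) * (x ^ i * y ^ j)) =
    (\<Sum>k\<le>Polynomial.degree h. of_int (Polynomial.coeff h k) * (\<Sum>l\<le>k. of_nat (k choose l)
      * (\<Sum>i<m. of_int (power_coeff f l i) * x ^ i) * (\<Sum>j<n. of_int (power_coeff g (k - l) j) * y ^ j)))"
proof -
  let ?t = "\<lambda>k l i j. of_int (Polynomial.coeff h k) * (of_nat (k choose l)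
    * (of_int (power_coeff f l i) * x ^ i) * (of_int (power_coeff g (k - l) j) * y ^ j))"
  have "(\<Sum>i<m. \<Sum>j<n. of_int (sum_coeff f g h i j) * (x ^ i * y ^ j)) =
      (\<Sum>i<m. \<Sum>j<n. \<Sum>k\<le>Polynomial.degree h. \<Sum>l\<le>k. ?t k l i j)"
    unfolding sum_coeff_def of_int_sum sum_distrib_right by (simp add: mult_ac)
  also have "\<dots> = (\<Sum>i<m. \<Sum>k\<le>Polynomial.degree h. \<Sum>j<n. \<Sum>l\<le>k. ?t k l i j)"
    by (intro sum.cong refl sum.swap)
  also have "\<dots> = (\<Sum>k\<le>Polynomial.degree h. \<Sum>i<m. \<Sum>j<n. \<Sum>l\<le>k. ?t k l i j)"
    by (rule sum.swap)
  also have "\<dots> = (\<Sum>k\<le>Polynomial.degree h. \<Sum>i<m. \<Sum>l\<le>k. \<Sum>j<n. ?t k l i j)"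
    by (intro sum.cong refl sum.swap)
  also have "\<dots> = (\<Sum>k\<le>Polynomial.degree h. \<Sum>l\<le>k. \<Sum>i<m. \<Sum>j<n. ?t k l i j)"
    by (intro sum.cong refl sum.swap)
  finally show ?thesis
    by (simp only: sum_distrib_left[symmetric] mult.assoc) (simp only: sum_distrib_right mult.assoc)
qed

lemma poly_add_eq_sum_coeff:
  fixes x y :: complex
  assumes "Polynomial.lead_coeff f = 1" "poly (map_poly of_int f) x = 0"
    and "Polynomial.lead_coeff g = 1" "poly (map_poly of_int g) y = 0"
  shows "poly (map_poly of_int h) (x + y) = (\<Sum>i<Polynomial.degree f. \<Sum>j<Polynomial.degree g.
    of_int (sum_coeff f g h i j) * (x ^ i * y ^ j))"
  \<comment> \<open>Read backwards, the reduction lemmas turn the inner sums into powers of x and y,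
    and the binomial theorem turns the sum over l into (x + y)^k.\<close>
  unfolding sum_coeff_expand power_eq_power_coeff[OF assms(1,2), symmetric]
    power_eq_power_coeff[OF assms(3,4), symmetric] binomial_ring[symmetric]
  by (simp add: poly_altdef coeff_map_poly)

lemma poly_add_cong_sum_coeff:
  fixes r s p :: int
  assumes "Polynomial.lead_coeff f = 1" "[poly f r = 0] (mod p)"
    and "Polynomial.lead_coeff g = 1" "[poly g s = 0] (mod p)"
  shows "[poly h (r + s) = (\<Sum>i<Polynomial.degree f. \<Sum>j<Polynomial.degree g.
    sum_coeff f g h i j * (r ^ i * s ^ j))] (mod p)"
proof -
  \<comment> \<open>The binomial expansion of h(r + s), with each power replaced by its remainder,
    to which it is congruent.\<close>
  have "[(\<Sum>k\<le>Polynomial.degree h. Polynomial.coeff h k * (\<Sum>l\<le>k. of_nat (k choose l) * r ^ l * s ^ (k - l))) =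
    (\<Sum>k\<le>Polynomial.degree h. Polynomial.coeff h k * (\<Sum>l\<le>k. of_nat (k choose l)
      * (\<Sum>i<Polynomial.degree f. power_coeff f l i * r ^ i)
      * (\<Sum>j<Polynomial.degree g. power_coeff g (k - l) j * s ^ j)))] (mod p)"
    by (intro cong_sum cong_mult cong_refl power_cong_power_coeff assms)
  then show ?thesis
    using sum_coeff_expand[of f g h r s "Polynomial.degree g" "Polynomial.degree f"]
    by (simp add: poly_altdef binomial_ring)
qed

section \<open>Sums of algebraic integers\<close>

text \<open>The equations make v an eigenvector of an integer matrix, non-zero because of its entry
  at \<open>i0\<close>; its eigenvalue is a root of the monic characteristic polynomial. A general
  finite index set allows pairs as indices.\<close>

lemma algebraic_int_if_int_matrix:
  fixes \<theta> :: complex and v :: "'i \<Rightarrow> complex" and A :: "'i \<Rightarrow> 'i \<Rightarrow> int"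
  assumes "finite I" and v: "i0 \<in> I" "v i0 \<noteq> 0"
    and A: "\<And>i. i \<in> I \<Longrightarrow> \<theta> * v i = (\<Sum>l\<in>I. of_int (A i l) * v l)"
  shows "algebraic_int \<theta>"
proof -
  define N where "N = card I"
  obtain b where b: "bij_betw b {0..<N} I"
    using ex_bij_betw_nat_finite[OF assms(1)] unfolding N_def by blast
  define M where "M = mat N N (\<lambda>(i, j). A (b i) (b j))"
  define w where "w = vec N (\<lambda>i. v (b i))"
  have M: "M \<in> carrier_mat N N"
    by (simp add: M_def)
  then have M': "map_mat complex_of_int M \<in> carrier_mat N N"
    by simp
  obtain k0 where k0: "k0 < N" "b k0 = i0"
    using b v(1) by (auto simp: bij_betw_def)
  then have "w \<noteq> 0\<^sub>v N"
    using v(2) by (metis index_vec index_zero_vec(1) w_def)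
  moreover have "map_mat complex_of_int M *\<^sub>v w = \<theta> \<cdot>\<^sub>v w"
  proof (rule eq_vecI)
    fix i assume "i < dim_vec (\<theta> \<cdot>\<^sub>v w)"
    then have i: "i < N"
      by (simp add: w_def)
    then have "b i \<in> I"
      using b by (auto simp: bij_betw_def)
    then have "\<theta> * v (b i) = (\<Sum>j = 0..<N. of_int (A (b i) (b j)) * v (b j))"
      using sum.reindex_bij_betw[OF b, of "\<lambda>l. of_int (A (b i) l) * v l"] A by simp
    then show "(map_mat complex_of_int M *\<^sub>v w) $ i = (\<theta> \<cdot>\<^sub>v w) $ i"
      using i by (simp add: M_def w_def scalar_prod_def)
  qed (simp add: M_def w_def)
  ultimately have "eigenvalue (map_mat complex_of_int M) \<theta>"
    using M by (auto simp: eigenvalue_def eigenvector_def w_def M_def intro!: exI[of _ w])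
  \<comment> \<open>Forming the characteristic polynomial commutes with embedding the integers into
    the complex numbers.\<close>
  then have "poly (map_poly complex_of_int (char_poly M)) \<theta> = 0"
    unfolding eigenvalue_root_char_poly[OF M'] of_int_hom.char_poly_hom[OF M] .
  then show ?thesis
    using degree_monic_char_poly[OF M] by (auto simp: algebraic_int_altdef_ipoly)
qed

lemma algebraic_int_add:
  fixes \<alpha> \<beta> :: complex
  assumes "algebraic_int \<alpha>" "algebraic_int \<beta>"
  shows "algebraic_int (\<alpha> + \<beta>)"
proof -
  obtain f where f: "poly (map_poly of_int f) \<alpha> = 0" "Polynomial.lead_coeff f = 1"
    using assms(1) by (auto simp: algebraic_int_altdef_ipoly)
  obtain g where g: "poly (map_poly of_int g) \<beta> = 0" "Polynomial.lead_coeff g = 1"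
    using assms(2) by (auto simp: algebraic_int_altdef_ipoly)
  \<comment> \<open>Positive degrees put (0, 0) into the index set, where the vector has the
    non-zero entry 1.\<close>
  have pos: "0 < Polynomial.degree F" if "poly (map_poly of_int F) \<theta> = 0" "Polynomial.lead_coeff F = 1"
    for F and \<theta> :: complex
  proof (rule ccontr)
    assume "\<not> 0 < Polynomial.degree F"
    then obtain a where "F = [:a:]"
      by (auto elim: degree_eq_zeroE)
    then show False
      using that by simp
  qed
  let ?u = "power_coeff f" and ?w = "power_coeff g"
  let ?I = "{..<Polynomial.degree f} \<times> {..<Polynomial.degree g}"
  let ?v = "\<lambda>(i, j). \<alpha> ^ i * \<beta> ^ j"
  \<comment> \<open>Row (i, j) expresses \<alpha>^(i+1) \<beta>^j + \<alpha>^i \<beta>^(j+1) in the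
    products, after reduction modulo f and g.\<close>
  let ?A = "\<lambda>(i, j) (i', j'). ?u (Suc i) i' * ?w j j' + ?u i i' * ?w (Suc j) j'"
  have prod: "\<alpha> ^ i * \<beta> ^ j = (\<Sum>(i', j')\<in>?I. of_int (?u i i' * ?w j j') * (\<alpha> ^ i' * \<beta> ^ j'))" for i j
    unfolding power_eq_power_coeff[OF f(2,1), of i] power_eq_power_coeff[OF g(2,1), of j]
      sum_product sum.cartesian_product
    by (intro sum.cong refl) (auto simp: mult_ac)
  show ?thesis
  proof (rule algebraic_int_if_int_matrix[where I = ?I and v = ?v and A = ?A])
    show "(0, 0) \<in> ?I" "?v (0, 0) \<noteq> 0"
      using pos[OF f] pos[OF g] by auto
    fix i assume "i \<in> ?I"
    obtain a b where i: "i = (a, b)"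
      by force
    have "(\<alpha> + \<beta>) * ?v i = \<alpha> ^ Suc a * \<beta> ^ b + \<alpha> ^ a * \<beta> ^ Suc b"
      by (simp add: i algebra_simps)
    also have "\<dots> = (\<Sum>l\<in>?I. of_int (?A i l) * ?v l)"
      unfolding prod[of "Suc a" b] prod[of a "Suc b"] i sum.distrib[symmetric]
      by (intro sum.cong refl) (auto simp: algebra_simps)
    finally show "(\<alpha> + \<beta>) * ?v i = (\<Sum>l\<in>?I. of_int (?A i l) * ?v l)" .
  qed simp
qed

section \<open>Independence of products in linearly disjoint fields\<close>

text \<open>The additive extension of b from the generators to the free abelian group. The general
  codomain covers both \<open>formal_mult\<close> and rational-valued maps.\<close>

definition formal_ext :: "('a \<Rightarrow> 'b::comm_ring_1) \<Rightarrow> ('a \<Rightarrow>\<^sub>0 int) \<Rightarrow> 'b" where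
  "formal_ext b c = (\<Sum>x\<in>Poly_Mapping.keys c. of_int (Poly_Mapping.lookup c x) * b x)"

lemma formal_mult_eq_formal_ext: "formal_mult = formal_ext (\<lambda>x. fst x * snd x)"
  by (rule ext) (simp add: formal_mult_def formal_ext_def)

lemma formal_ext_supset:
  assumes "finite A" "Poly_Mapping.keys c \<subseteq> A"
  shows "formal_ext b c = (\<Sum>x\<in>A. of_int (Poly_Mapping.lookup c x) * b x)"
  unfolding formal_ext_def
  by (rule sum.mono_neutral_left) (use assms in \<open>auto simp: in_keys_iff\<close>)

lemma formal_ext_0 [simp]: "formal_ext b 0 = 0"
  by (simp add: formal_ext_def)

lemma formal_ext_frag_of [simp]: "formal_ext b (frag_of x) = b x"
  by (simp add: formal_ext_def)

lemma formal_ext_frag_cmul [simp]: "formal_ext b (frag_cmul k c) = of_int k * formal_ext b c"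
proof -
  \<comment> \<open>For \<open>k = 0\<close> the support shrinks, so the sum is taken over the
    support of c.\<close>
  have "formal_ext b (frag_cmul k c)
      = (\<Sum>x\<in>Poly_Mapping.keys c. of_int (Poly_Mapping.lookup (frag_cmul k c) x) * b x)"
    by (rule formal_ext_supset) (auto intro: subsetD[OF keys_cmul])
  then show ?thesis
    by (simp add: formal_ext_def sum_distrib_left mult.assoc)
qed

lemma formal_ext_add: "formal_ext b (c + d) = formal_ext b c + formal_ext b d"
proof -
  let ?A = "Poly_Mapping.keys c \<union> Poly_Mapping.keys d"
  have "Poly_Mapping.keys (c + d) \<subseteq> ?A"
    by (rule keys_add)
  then show ?thesis
    by (simp add: formal_ext_supset[of ?A] lookup_add algebra_simps sum.distrib)
qed

lemma formal_ext_diff: "formal_ext b (c - d) = formal_ext b c - formal_ext b d"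
  using formal_ext_add[of b "c - d" d] by simp

lemma formal_ext_sum: "formal_ext b (\<Sum>i\<in>I. c i) = (\<Sum>i\<in>I. formal_ext b (c i))"
  by (induction I rule: infinite_finite_induct) (simp_all add: formal_ext_add)

section \<open>Rational functionals on the complex numbers\<close>

interpretation complex_rat: vector_space_pair "\<lambda>(q::rat) (z::complex). of_rat q * z" "(*) :: rat \<Rightarrow> rat \<Rightarrow> rat"
  by unfold_locales (simp_all add: algebra_simps of_rat_add of_rat_mult)

text \<open>Functionals are defined on all complex numbers, so the subfields need not be treated as
  vector spaces of their own.\<close>

abbreviation rat_linear :: "(complex \<Rightarrow> rat) \<Rightarrow> bool" where
  "rat_linear \<equiv> Vector_Spaces.linear (\<lambda>q z. of_rat q * z) (*)"

text \<open>The map (a, b) to \<phi>(a) \<psi>(b) is bilinear over the rationals, so its additive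
  extension kills the three families of relations and descends to the tensor product.\<close>

lemma formal_ext_tensor_subgroup:
  assumes rel: "tensor_relations L1 L2 \<subseteq> carrier (free_Abelian_group (L1 \<times> L2))"
    and "rat_linear \<phi>" "rat_linear \<psi>" and c: "c \<in> tensor_subgroup L1 L2"
  shows "formal_ext (\<lambda>x. \<phi> (fst x) * \<psi> (snd x)) c = 0"
proof -
  let ?b = "\<lambda>x. \<phi> (fst x) * \<psi> (snd x)"
  interpret \<phi>: Vector_Spaces.linear "\<lambda>q z. of_rat q * z" "(*)" \<phi> by fact
  interpret \<psi>: Vector_Spaces.linear "\<lambda>q z. of_rat q * z" "(*)" \<psi> by fact
  have rel0: "formal_ext ?b h = 0" if "h \<in> tensor_relations L1 L2" for h
    using that unfolding tensor_relations_def
    by (elim UnE CollectE exE conjE)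
      (simp_all add: formal_ext_diff \<phi>.add \<psi>.add \<phi>.scale \<psi>.scale ring_distribs)
  show ?thesis
    using c unfolding tensor_subgroup_def
  proof (induction rule: generate.induct)
    case one
    then show ?case by simp
  next
    case (incl h)
    then show ?case by (rule rel0)
  next
    case (inv h)
    have "inv\<^bsub>free_Abelian_group (L1 \<times> L2)\<^esub> h = - h"
      using subsetD[OF rel inv] inv_free_Abelian_group
      unfolding carrier_free_Abelian_group_iff by blast
    then show ?case
      using rel0[OF inv] formal_ext_diff[of ?b 0 h] by simp
  next
    case (eng h1 h2)
    then show ?case by (simp add: formal_ext_add)
  qed
qed

text \<open>A non-trivial relation would be a non-zero polynomial of degree below that of h
  vanishing at \<theta>, against minimality.\<close>

lemma minpoly_powers_independent:
  assumes "is_rat_minpoly \<theta> h" and "(\<Sum>i<Polynomial.degree h. of_rat (q i) * \<theta> ^ i) = 0"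
    and "i < Polynomial.degree h"
  shows "q i = 0"
proof (rule ccontr)
  define g where "g = (\<Sum>i<Polynomial.degree h. Polynomial.monom (q i) i)"
  have coeff_g: "Polynomial.coeff g j = (if j < Polynomial.degree h then q j else 0)" for j
    by (simp add: g_def coeff_sum if_distrib cong: if_cong)
  assume "q i \<noteq> 0"
  then have "g \<noteq> 0"
    using coeff_g[of i] assms(3) by auto
  have "map_poly of_rat g = (\<Sum>i<Polynomial.degree h. Polynomial.monom (of_rat (q i)) i :: complex poly)"
    by (rule poly_eqI) (simp add: coeff_map_poly coeff_g coeff_sum if_distrib cong: if_cong)
  then have "poly (map_poly of_rat g) \<theta> = 0"
    using assms(2) by (simp add: poly_sum poly_monom)
  then have "Polynomial.degree h \<le> Polynomial.degree g"
    using assms(1) \<open>g \<noteq> 0\<close> by (auto simp: is_rat_minpoly_def)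
  then have "Polynomial.coeff g (Polynomial.degree g) = 0"
    by (simp add: coeff_g)
  then show False
    using \<open>g \<noteq> 0\<close> by simp
qed

text \<open>A product of coordinate functionals vanishes on the tensor relations, so these functionals
  detect the coefficients of an element of the tensor product.\<close>

lemma dual_functional:
  assumes h: "is_rat_minpoly \<theta> h" and "k < Polynomial.degree h"
  obtains \<phi> where "rat_linear \<phi>"
    and "\<And>i. i < Polynomial.degree h \<Longrightarrow> \<phi> (\<theta> ^ i) = (if i = k then 1 else 0)"
proof -
  let ?m = "Polynomial.degree h"
  \<comment> \<open>Independence is stated for a set, so the powers must be distinct: \<theta>^i =
    \<theta>^j would be a relation with the coefficients of x^i - x^j.\<close>
  have inj: "inj_on (\<lambda>i. \<theta> ^ i) {..<?m}"
  proof (rule inj_onI, rule ccontr)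
    fix i j assume ij: "i \<in> {..<?m}" "j \<in> {..<?m}" "\<theta> ^ i = \<theta> ^ j" "i \<noteq> j"
    let ?q = "\<lambda>l. (if l = i then 1 else 0) - (if l = j then 1 else 0) :: rat"
    have "(\<Sum>l<?m. of_rat (?q l) * \<theta> ^ l)
        = (\<Sum>l<?m. if l = i then \<theta> ^ l else 0) - (\<Sum>l<?m. if l = j then \<theta> ^ l else 0)"
      unfolding sum_subtractf[symmetric] by (intro sum.cong) auto
    also have "\<dots> = 0"
      using ij by simp
    finally show False
      using minpoly_powers_independent[OF h, of ?q i] ij by auto
  qed
  have "complex_rat.vs1.independent ((\<lambda>i. \<theta> ^ i) ` {..<?m})"
  proof (rule complex_rat.vs1.independent_if_scalars_zero)
    fix c x assume c: "(\<Sum>x\<in>(\<lambda>i. \<theta> ^ i) ` {..<?m}. of_rat (c x) * x) = 0"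
      and x: "x \<in> (\<lambda>i. \<theta> ^ i) ` {..<?m}"
    then show "c x = 0"
      using minpoly_powers_independent[OF h, of "\<lambda>i. c (\<theta> ^ i)"]
      by (auto simp: sum.reindex[OF inj])
  qed simp
  \<comment> \<open>The values on the independent powers, 1 at \<theta>^k and 0 at the others,
    extend to a functional on all complex numbers.\<close>
  from complex_rat.linear_independent_extend[OF this, of "\<lambda>x. if x = \<theta> ^ k then 1 else 0"]
  obtain \<phi> where "rat_linear \<phi>"
    and \<phi>: "\<forall>x\<in>(\<lambda>i. \<theta> ^ i) ` {..<?m}. \<phi> x = (if x = \<theta> ^ k then 1 else 0)"
    by blast
  moreover have "\<phi> (\<theta> ^ i) = (if i = k then 1 else 0)" if "i < ?m" for i
    using \<phi> that assms(2) inj_onD[OF inj, of i k] by auto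
  ultimately show ?thesis
    using that by blast
qed

lemma rat_adjoin_power: "\<theta> ^ i \<in> rat_adjoin \<theta>"
proof -
  interpret field "ring_of_type_algebra :: complex ring"
    by (rule field_from_type_algebra)
  note S = subfieldE(1)[OF subfield_rat_adjoin[of \<theta>]]
  have "\<theta> \<in> rat_adjoin \<theta>"
    unfolding rat_adjoin_def by (intro generate_field.incl) simp
  then show ?thesis
    using subringE(3,6)[OF S] by (induction i) (simp_all add: ring_of_type_algebra_def)
qed

text \<open>The relation lifts to a formal sum whose class is sent to 0 by multiplication.
  Injectivity makes that class trivial, and a product of dual functionals then reads off the single
  coefficient \<open>e i j\<close>.\<close>

lemma linearly_disjoint_powers_independent:
  fixes e :: "nat \<Rightarrow> nat \<Rightarrow> int"
  assumes disj: "linearly_disjoint (rat_adjoin \<alpha>) (rat_adjoin \<beta>)"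
    and f: "is_rat_minpoly \<alpha> f" and g: "is_rat_minpoly \<beta> g"
    and zero: "(\<Sum>i<Polynomial.degree f. \<Sum>j<Polynomial.degree g. of_int (e i j) * (\<alpha> ^ i * \<beta> ^ j)) = 0"
    and ij: "i < Polynomial.degree f" "j < Polynomial.degree g"
  shows "e i j = 0"
proof -
  let ?L1 = "rat_adjoin \<alpha>" and ?L2 = "rat_adjoin \<beta>"
  let ?G = "free_Abelian_group (?L1 \<times> ?L2)" and ?H = "tensor_subgroup ?L1 ?L2"
  note rel = tensor_relations_carrier[OF subfield_rat_adjoin[of \<alpha>] subfield_rat_adjoin[of \<beta>]]
  interpret G: comm_group ?G
    by (rule abelian_free_Abelian_group)
  have H: "subgroup ?H ?G"
    unfolding tensor_subgroup_def by (rule G.generate_is_subgroup[OF rel])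
  define c where "c = (\<Sum>i<Polynomial.degree f. \<Sum>j<Polynomial.degree g.
    frag_cmul (e i j) (frag_of (\<alpha> ^ i, \<beta> ^ j)))"
  have c: "c \<in> carrier ?G"
    unfolding c_def carrier_free_Abelian_group_iff
    by (intro order.trans[OF keys_sum] UN_least order.trans[OF keys_cmul])
      (simp add: rat_adjoin_power)
  \<comment> \<open>Polymorphic in the codomain: needed for the complex product map and for rational
    functionals.\<close>
  have ext: "formal_ext b c = (\<Sum>i<Polynomial.degree f. \<Sum>j<Polynomial.degree g.
      of_int (e i j) * b (\<alpha> ^ i, \<beta> ^ j))" for b :: "_ \<Rightarrow> 'b::comm_ring_1"
    by (simp add: c_def formal_ext_sum)
  \<comment> \<open>Both cosets are sent to 0; the right one is the neutral class, the subgroup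
    itself.\<close>
  have "tensor_mult (?H #>\<^bsub>?G\<^esub> c) = tensor_mult (?H #>\<^bsub>?G\<^esub> \<one>\<^bsub>?G\<^esub>)"
    unfolding tensor_mult_coset[OF rel] using zero by (simp add: formal_mult_eq_formal_ext ext)
  moreover have "?H #>\<^bsub>?G\<^esub> x \<in> carrier (rat_tensor ?L1 ?L2)" if "x \<in> carrier ?G" for x
    using that G.subgroup_imp_normal[OF H] by (auto simp: rat_tensor_def FactGroup_def RCOSETS_def)
  ultimately have "?H #>\<^bsub>?G\<^esub> c = ?H #>\<^bsub>?G\<^esub> \<one>\<^bsub>?G\<^esub>"
    using disj c G.one_closed unfolding linearly_disjoint_def inj_on_def by blast
  then have "c \<in> ?H"
    using G.rcos_self[OF c H] G.coset_mult_one[OF subgroup.subset[OF H]] by simp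
  \<comment> \<open>The functionals dual to \<alpha>^i and \<beta>^j: their product vanishes at c,
    which lies in \<open>?H\<close>, yet sends c to \<open>e i j\<close>.\<close>
  obtain \<phi> where \<phi>: "rat_linear \<phi>"
    "\<And>i'. i' < Polynomial.degree f \<Longrightarrow> \<phi> (\<alpha> ^ i') = (if i' = i then 1 else 0)"
    using dual_functional[OF f ij(1)] by blast
  obtain \<psi> where \<psi>: "rat_linear \<psi>"
    "\<And>j'. j' < Polynomial.degree g \<Longrightarrow> \<psi> (\<beta> ^ j') = (if j' = j then 1 else 0)"
    using dual_functional[OF g ij(2)] by blast
  have "0 = formal_ext (\<lambda>x. \<phi> (fst x) * \<psi> (snd x)) c"
    using formal_ext_tensor_subgroup[OF rel \<phi>(1) \<psi>(1) \<open>c \<in> ?H\<close>] by simp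
  also have "\<dots> = (\<Sum>i'<Polynomial.degree f. \<Sum>j'<Polynomial.degree g.
      if i' = i then if j' = j then of_int (e i' j') else 0 else 0)"
    unfolding ext by (intro sum.cong refl) (simp add: \<phi>(2) \<psi>(2))
  also have "\<dots> = (\<Sum>i'<Polynomial.degree f. if i' = i then of_int (e i' j) else 0)"
    using ij by (intro sum.cong refl) simp
  also have "\<dots> = of_int (e i j)"
    using ij by simp
  finally show ?thesis
    by simp
qed

section \<open>Integer minimal polynomials and the conclusion modulo p\<close>

lemma int_minpoly_monic_root:
  assumes "algebraic_int \<theta>"
  shows "Polynomial.lead_coeff (int_minpoly \<theta>) = 1"
    and "poly (map_poly of_int (int_minpoly \<theta>)) \<theta> = 0"
proof -
  have "map_poly of_rat (map_poly of_int h) = (map_poly of_int h :: complex poly)" for h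
    by (rule poly_eqI) (simp add: coeff_map_poly)
  then show "poly (map_poly of_int (int_minpoly \<theta>)) \<theta> = 0"
    using int_minpoly[OF assms] by (simp add: is_rat_minpoly_def)
  show "Polynomial.lead_coeff (int_minpoly \<theta>) = 1"
    using int_minpoly[OF assms] by (simp add: is_rat_minpoly_def coeff_map_poly degree_map_poly)
qed

theorem proposition3p3:
  fixes \<alpha> \<beta> :: complex and p :: nat and r s :: int
  assumes "algebraic_int \<alpha>" and "algebraic_int \<beta>"
    and "linearly_disjoint (rat_adjoin \<alpha>) (rat_adjoin \<beta>)"
    and "Factorial_Ring.prime p"
    and "first_degree_prime_ideal \<alpha> (r, p)"
    and "first_degree_prime_ideal \<beta> (s, p)"
  shows "first_degree_prime_ideal (\<alpha> + \<beta>) (r \<oplus>\<^bsub>residue_ring (int p)\<^esub> s, p)"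
proof -
  let ?f = "int_minpoly \<alpha>" and ?g = "int_minpoly \<beta>" and ?h = "int_minpoly (\<alpha> + \<beta>)"
  note f = int_minpoly_monic_root[OF assms(1)] and g = int_minpoly_monic_root[OF assms(2)]
    and h = int_minpoly_monic_root[OF algebraic_int_add[OF assms(1,2)]]
  have r: "[poly ?f r = 0] (mod int p)" and s: "[poly ?g s = 0] (mod int p)"
    using assms(5,6) by (auto simp: first_degree_prime_ideal_def)
  \<comment> \<open>Independence is indexed by degrees over the rationals, \<open>sum_coeff\<close>
    by degrees over the integers; they agree.\<close>
  have deg: "Polynomial.degree (map_poly of_int F :: rat poly) = Polynomial.degree F" for F
    by (simp add: degree_map_poly)
  have "sum_coeff ?f ?g ?h i j = 0" if "i < Polynomial.degree ?f" "j < Polynomial.degree ?g" for i j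
    using linearly_disjoint_powers_independent
      [OF assms(3) int_minpoly[OF assms(1)] int_minpoly[OF assms(2)], unfolded deg]
      poly_add_eq_sum_coeff[OF f g, of ?h] h(2) that by simp
  then have "[poly ?h (r + s) = 0] (mod int p)"
    using poly_add_cong_sum_coeff[OF f(1) r g(1) s, of ?h] by simp
  \<comment> \<open>Addition in \<open>residue_ring\<close> yields the reduced representative of r +
    s, and the value of \<open>?h\<close> modulo p depends only on the residue class.\<close>
  moreover have "[poly ?h ((r + s) mod int p) = poly ?h (r + s)] (mod int p)"
    unfolding poly_altdef by (intro cong_sum cong_mult cong_pow cong_refl) simp
  ultimately have "[poly ?h ((r + s) mod int p) = 0] (mod int p)"
    using cong_trans by blast
  moreover have "p > 0"
    using assms(4) by (simp add: prime_gt_0_nat)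
  ultimately show ?thesis
    using assms(4) by (auto simp: first_degree_prime_ideal_def residue_ring_def)
qed

end
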